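(* The SlotAlgorithm for online strip packing of squares under the Tetris and gravity constraints is (asymptotically) $2.6154$-competitive; that is, there is a constant $b$ such that for every finite input sequence of squares with side lengths in $(0,1]$, the height of the packing produced by SlotAlgorithm is at most $2.6154\cdot OPT + b$, where $OPT$ is the height of an optimal packing of the same squares.
   Context: Problem (online square strip packing with Tetris and gravity constraints): Let $S$ be a semi-infinite vertical strip of width $1$. A sequence of axis-parallel squares $A_1,\dots,A_n$ with side lengths $a_i\in(0,1]$ arrives online, one at a time, unknown in advance; each square must be placed irrevocably before the next is revealed, starting from a position above all previously placed squares. Squares may not overlap and must have sides parallel to the strip. Tetris constraint: when a square is placed, there must be a collision-free path through unoccupied space from its initial position at the top of the strip to its final position. Gravity constraint: no square ever moves upward on its path, and in its final position its bottom side lies on the bottom of the strip or shares a segment of positive length with the top side of a previously placed square. The height of a packing is the distance from the bottom of $S$ to the highest occupied point; $OPT$ is the minimum possible height of a packing of the given squares. SlotAlgorithm: For every $j=0,1,2,\dots$, the strip is divided into $2^j$ slots of width $2^{-j}$ placed side by side (a slot is the region between two vertical lines rising from the bottom of $S$; so each slot of width $2^{-j}$ consists of two slots of width $2^{-j-1}$). For each arriving square $A_i$, let $2^{-k_i}$ be the smallest power of two (with integer $k_i\ge 0$) that is $\ge a_i$. Among all slots of width $2^{-k_i}$, choose the one in which $A_i$ can be placed nearest to the bottom of $S$, and place $A_i$ there by moving it down along the left boundary of that slot until it reaches another square (or the bottom of $S$). An online algorithm is (asymptotically) $c$-competitive if there is a constant $b$ such that for every input its height is at most $c\cdot OPT+b$.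 *)

theory Defs
  imports "HOL-Analysis.Analysis"
begin

text \<open>
  A placed square is given by the coordinates of its lower left corner and its side length.
  The strip is \<open>{0..1} \<times> {0..}\<close>.
\<close>

datatype placed = Placed (xpos: real) (ypos: real) (side: real)

definition top_of :: "placed \<Rightarrow> real" where
  "top_of s = ypos s + side s"

definition open_square :: "placed \<Rightarrow> (real \<times> real) set" where
  "open_square s = {xpos s <..< xpos s + side s} \<times> {ypos s <..< ypos s + side s}"

text \<open>Squares may touch, so only the interiors have to be disjoint.\<close>

definition overlap :: "placed \<Rightarrow> placed \<Rightarrow> bool" where
  "overlap s t \<longleftrightarrow> open_square s \<inter> open_square t \<noteq> {}"

definition in_strip :: "placed \<Rightarrow> bool" where
  "in_strip s \<longleftrightarrow> 0 \<le> xpos s \<and> xpos s + side s \<le> 1 \<and> 0 \<le> ypos s"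

definition strip_packing :: "placed list \<Rightarrow> bool" where
  "strip_packing P \<longleftrightarrow>
     (\<forall>s \<in> set P. in_strip s) \<and>
     (\<forall>i j. i < j \<and> j < length P \<longrightarrow> \<not> overlap (P ! i) (P ! j))"

definition packing_height :: "placed list \<Rightarrow> real" where
  "packing_height P = Max (insert 0 (top_of ` set P))"

text \<open>
  The offline optimum ranges over all non-overlapping packings of the given squares; neither the
  arrival order nor the Tetris and gravity constraints restrict it.
\<close>

definition OPT :: "real list \<Rightarrow> real" where
  "OPT as = Inf {packing_height Q | Q. strip_packing Q \<and> map side Q = as}"


text \<open>
  In the next definitions, \<open>P\<close> lists the squares placed before \<open>s\<close>. The path \<open>g\<close> is that of the
  lower left corner of \<open>s\<close>; its second coordinate never increases.
\<close>

definition descending_free_path :: "placed list \<Rightarrow> placed \<Rightarrow> (real \<Rightarrow> real \<times> real) \<Rightarrow> bool" where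
  "descending_free_path P s g \<longleftrightarrow>
     path g \<and>
     (\<forall>t \<in> set P. top_of t \<le> snd (pathstart g)) \<and>
     pathfinish g = (xpos s, ypos s) \<and>
     (\<forall>u \<in> {0..1}. in_strip (Placed (fst (g u)) (snd (g u)) (side s)) \<and>
        (\<forall>t \<in> set P. \<not> overlap (Placed (fst (g u)) (snd (g u)) (side s)) t)) \<and>
     antimono_on {0..1} (\<lambda>u. snd (g u))"

definition supported :: "placed list \<Rightarrow> placed \<Rightarrow> bool" where
  "supported P s \<longleftrightarrow>
     ypos s = 0 \<or>
     (\<exists>t \<in> set P. ypos s = top_of t \<and>
        max (xpos s) (xpos t) < min (xpos s + side s) (xpos t + side t))"

definition tetris_gravity_packing :: "placed list \<Rightarrow> bool" where
  "tetris_gravity_packing P \<longleftrightarrow>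
     strip_packing P \<and>
     (\<forall>i < length P. (\<exists>g. descending_free_path (take i P) (P ! i) g) \<and> supported (take i P) (P ! i))"


text \<open>
  An online algorithm is a (possibly nondeterministic) rule \<open>A P a s\<close>: after the squares \<open>P\<close> have
  been placed, an arriving square of side length \<open>a\<close> may become the placed square \<open>s\<close>.
\<close>

type_synonym online_rule = "placed list \<Rightarrow> real \<Rightarrow> placed \<Rightarrow> bool"

inductive online_run :: "online_rule \<Rightarrow> real list \<Rightarrow> placed list \<Rightarrow> bool" for A where
  Nil: "online_run A [] []"
| snoc: "online_run A as P \<Longrightarrow> A P a s \<Longrightarrow> online_run A (as @ [a]) (P @ [s])"

definition valid_input :: "real list \<Rightarrow> bool" where
  "valid_input as \<longleftrightarrow> set as \<subseteq> {0 <.. 1}"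

text \<open>The first conjunct says that the rule never gets stuck.\<close>

definition tetris_gravity_algorithm :: "online_rule \<Rightarrow> bool" where
  "tetris_gravity_algorithm A \<longleftrightarrow>
     (\<forall>as a P. valid_input (as @ [a]) \<and> online_run A as P \<longrightarrow> (\<exists>s. A P a s)) \<and>
     (\<forall>as P. valid_input as \<and> online_run A as P \<longrightarrow> map side P = as \<and> tetris_gravity_packing P)"

definition asymptotically_competitive :: "real \<Rightarrow> online_rule \<Rightarrow> bool" where
  "asymptotically_competitive c A \<longleftrightarrow>
     (\<exists>b. \<forall>as P. valid_input as \<and> online_run A as P \<longrightarrow> packing_height P \<le> c * OPT as + b)"


definition slot_exponent :: "real \<Rightarrow> nat" where
  "slot_exponent a = (GREATEST k. a \<le> 1 / 2 ^ k)"

text \<open>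
  The resting height of a square of side length \<open>a\<close> that is moved straight down, from above all
  squares in \<open>P\<close>, with its left side on the vertical line at \<open>x\<close>.
\<close>

definition drop_height :: "placed list \<Rightarrow> real \<Rightarrow> real \<Rightarrow> real" where
  "drop_height P x a =
     (LEAST y. 0 \<le> y \<and> (\<forall>y' \<ge> y. \<forall>t \<in> set P. \<not> overlap (Placed x y' a) t))"

text \<open>
  The slots of width \<open>1 / 2 ^ k\<close> have their left boundaries at \<open>j / 2 ^ k\<close> for \<open>j < 2 ^ k\<close>.
  Ties between equally low slots may be broken arbitrarily.
\<close>

definition slot_algorithm :: online_rule where
  "slot_algorithm P a s \<longleftrightarrow>
     (let k = slot_exponent a; h = (\<lambda>j::nat. drop_height P (real j / 2 ^ k) a) in
      \<exists>j < 2 ^ k. (\<forall>i < 2 ^ k. h j \<le> h i) \<and> s = Placed (real j / 2 ^ k) (h j) a)"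


lemma overlap_iff:
  assumes "0 < side s" "0 < side t"
  shows "overlap s t \<longleftrightarrow>
    xpos s < xpos t + side t \<and> xpos t < xpos s + side s \<and> ypos s < top_of t \<and> ypos t < top_of s"
proof -
  have ne: "{a <..< a + p} \<inter> {b <..< b + q} \<noteq> {} \<longleftrightarrow> a < b + q \<and> b < a + p"
    if "0 < p" "0 < q" for a b p q :: real
  proof -
    have "{a <..< a + p} \<inter> {b <..< b + q} = {max a b <..< min (a + p) (b + q)}"
      by auto
    then show ?thesis
      using that by (simp add: not_le) auto
  qed
  show ?thesis
    unfolding overlap_def open_square_def Times_Int_Times top_of_def
    using ne[OF assms, of "xpos s" "xpos t"] ne[OF assms, of "ypos s" "ypos t"] by blast
qed

lemma drop_height_eq:
  assumes a: "0 < a" and P: "\<forall>t \<in> set P. 0 < side t"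
  shows "drop_height P x a =
    Max (insert 0 (top_of ` {t \<in> set P. x < xpos t + side t \<and> xpos t < x + a}))"
    (is "_ = ?M")
proof -
  let ?B = "{t \<in> set P. x < xpos t + side t \<and> xpos t < x + a}"
  have fin: "finite (insert 0 (top_of ` ?B))" by simp
  have ge: "top_of t \<le> ?M" if "t \<in> ?B" for t
    using that fin by (intro Max_ge) auto
  show ?thesis
    unfolding drop_height_def
  proof (rule Least_equality, intro conjI allI impI ballI)
    show "0 \<le> ?M" using fin by (intro Max_ge) auto
  next
    fix y' t assume y': "?M \<le> y'" and t: "t \<in> set P"
    show "\<not> overlap (Placed x y' a) t"
      using ge[of t] y' t a P by (auto simp: overlap_iff)
  next
    fix y assume y: "0 \<le> y \<and> (\<forall>y' \<ge> y. \<forall>t \<in> set P. \<not> overlap (Placed x y' a) t)"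
    have "top_of t \<le> y" if t: "t \<in> ?B" for t
    proof (rule ccontr)
      assume "\<not> top_of t \<le> y"
      moreover have "ypos t < top_of t" using t P by (auto simp: top_of_def)
      ultimately obtain y' where "max y (ypos t) < y'" "y' < top_of t"
        using dense[of "max y (ypos t)" "top_of t"] by auto
      moreover have "overlap (Placed x y' a) t"
        using calculation t a P by (subst overlap_iff) (auto simp: top_of_def)
      ultimately show False using y t by auto
    qed
    then show "?M \<le> y" using y fin by (subst Max_le_iff) auto
  qed
qed

lemma le_inverse_power_slot_exponent:
  assumes "0 < a" "a \<le> 1"
  shows "a \<le> 1 / 2 ^ slot_exponent a"
proof -
  obtain n where n: "(1/2::real) ^ n < a"
    using real_arch_pow_inv[of a "1/2"] assms by auto
  have "k \<le> n" if "a \<le> 1 / 2 ^ k" for k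
  proof (rule ccontr)
    assume "\<not> k \<le> n"
    then have "(1/2::real) ^ k \<le> (1/2) ^ n" by (intro power_decreasing) auto
    with n that show False by (simp add: power_one_over)
  qed
  then show ?thesis
    unfolding slot_exponent_def
    by (rule GreatestI_nat[where k = 0 and b = n, rotated]) (use assms in auto)
qed

lemma slot_algorithm_total: "\<exists>s. slot_algorithm P a s"
proof -
  define k where "k = slot_exponent a"
  define h where "h = (\<lambda>j::nat. drop_height P (real j / 2 ^ k) a)"
  have "{..<(2::nat) ^ k} \<noteq> {}" by (simp add: lessThan_empty_iff)
  then have "Min (h ` {..<2 ^ k}) \<in> h ` {..<2 ^ k}" by (intro Min_in) blast+
  then obtain j where j: "j < (2::nat) ^ k" "h j = Min (h ` {..<2 ^ k})" by auto
  then have "\<forall>i < 2 ^ k. h j \<le> h i" by auto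
  with j(1) show ?thesis
    unfolding slot_algorithm_def Let_def k_def h_def by blast
qed

lemma slot_algorithm_placement:
  assumes a: "0 < a" "a \<le> 1" and P: "\<forall>t \<in> set P. 0 < side t" and s: "slot_algorithm P a s"
  shows "side s = a" "in_strip s" "\<forall>t \<in> set P. \<not> overlap s t"
    "\<exists>g. descending_free_path P s g" "supported P s"
proof -
  define k where "k = slot_exponent a"
  from s obtain j where j: "j < (2::nat) ^ k"
    and s_eq: "s = Placed (real j / 2 ^ k) (drop_height P (real j / 2 ^ k) a) a"
    unfolding slot_algorithm_def Let_def k_def by blast
  define x where "x = real j / 2 ^ k"
  define d where "d = drop_height P x a"
  let ?B = "{t \<in> set P. x < xpos t + side t \<and> xpos t < x + a}"
  have d: "d = Max (insert 0 (top_of ` ?B))"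
    unfolding d_def using a(1) P by (rule drop_height_eq)
  have s_eq: "s = Placed x d a" by (simp add: s_eq x_def d_def)
  have d_ge: "top_of t \<le> d" if "t \<in> ?B" for t
    unfolding d by (rule Max_ge) (use that in auto)
  have d0: "0 \<le> d" unfolding d by (rule Max_ge) auto
  have d_in: "d \<in> insert 0 (top_of ` ?B)" unfolding d by (rule Max_in) auto
  have "real (j + 1) \<le> real (2 ^ k)" using j by (simp only: of_nat_le_iff)
  then have "real j / 2 ^ k + 1 / 2 ^ k \<le> 1" by (simp add: field_simps)
  moreover have "a \<le> 1 / 2 ^ k"
    unfolding k_def using a by (rule le_inverse_power_slot_exponent)
  ultimately have xa: "0 \<le> x" "x + a \<le> 1" by (auto simp: x_def)
  have free: "\<not> overlap (Placed x y a) t" if "d \<le> y" "t \<in> set P" for y t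
    using d_ge[of t] that a(1) P by (auto simp: overlap_iff)
  show "side s = a" "in_strip s" "\<forall>t \<in> set P. \<not> overlap s t"
    using xa d0 free by (auto simp: s_eq in_strip_def)
  show "supported P s"
  proof (cases "d = 0")
    case False
    then obtain t where "t \<in> ?B" "d = top_of t" using d_in by auto
    then show ?thesis using P a(1) by (auto simp: supported_def s_eq)
  qed (simp add: supported_def s_eq)
  define m where "m = max d (packing_height P)"
  have m: "d \<le> m" "\<forall>t \<in> set P. top_of t \<le> m"
    by (auto simp: m_def packing_height_def le_max_iff_disj)
  define g where "g = (\<lambda>u. (x, m + u * (d - m)))"
  have ge: "d \<le> m + u * (d - m)" if "u \<in> {0..1}" for u
  proof -
    have "0 \<le> (1 - u) * (m - d)" using that m(1) by auto
    then show ?thesis by (simp add: algebra_simps)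
  qed
  have "path g" unfolding path_def g_def by (intro continuous_intros)
  moreover have "antimono_on {0..1} (\<lambda>u. snd (g u))"
    unfolding g_def using m(1) by (intro monotone_onI) (auto intro: mult_right_mono_neg)
  ultimately have "descending_free_path P s g"
    unfolding descending_free_path_def
    using m ge free xa d0
    by (auto simp: g_def s_eq pathstart_def pathfinish_def in_strip_def intro: order_trans[OF d0])
  then show "\<exists>g. descending_free_path P s g" by blast
qed

lemma tetris_gravity_packing_snoc:
  assumes "tetris_gravity_packing P" "in_strip s" "\<forall>t \<in> set P. \<not> overlap s t"
    "\<exists>g. descending_free_path P s g" "supported P s"
  shows "tetris_gravity_packing (P @ [s])"
proof -
  have "\<not> overlap t s" if "t \<in> set P" for t
    using that assms(3) by (auto simp: overlap_def)
  then show ?thesis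
    using assms unfolding tetris_gravity_packing_def strip_packing_def
    by (auto simp: nth_append less_Suc_eq all_conj_distrib)
qed

lemma tetris_gravity_algorithm_slot_algorithm: "tetris_gravity_algorithm slot_algorithm"
proof -
  have "map side P = as \<and> tetris_gravity_packing P"
    if "online_run slot_algorithm as P" "valid_input as" for as P
    using that
  proof (induction rule: online_run.induct)
    case Nil
    show ?case by (simp add: tetris_gravity_packing_def strip_packing_def)
  next
    case (snoc as P a s)
    then have a: "0 < a" "a \<le> 1" and IH: "map side P = as" "tetris_gravity_packing P"
      and as: "\<forall>b \<in> set as. 0 < b"
      by (auto simp: valid_input_def)
    from IH(1) as have P: "\<forall>t \<in> set P. 0 < side t" by auto
    note pl = slot_algorithm_placement[OF a P snoc.hyps(2)]
    show ?case
      using IH(1) pl(1) tetris_gravity_packing_snoc[OF IH(2) pl(2-5)] by simp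
  qed
  then show ?thesis
    unfolding tetris_gravity_algorithm_def using slot_algorithm_total by blast
qed

end

theory Submission
  imports Defs
begin

text \<open>
  The total area is at most \<open>OPT\<close>, so it is enough to pay for the height with \<open>13/5\<close> times the
  area of each square. The payments are kept as a mass on \<open>[0, 1]\<close> with distribution function
  \<open>\<Phi>\<close>, and every slot of width \<open>w\<close> always holds mass for its full reach up to a loss of
  \<open>3/20 * w\<^sup>2\<close>, plus a bonus that decreases linearly from left to right. A square in a slot
  of its own size class recovers the loss, because \<open>w * a + 3/20 * w\<^sup>2 \<le> 13/5 * a\<^sup>2\<close> for
  \<open>a \<ge> w / 2\<close>, and its mass is redistributed inside the slot. For a larger slot
  that a smaller square makes higher, one adds up the invariants of the subslots of the size class
  of the square: by the choice of the algorithm they all reach at least its bottom.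

  Without the bonus this argument needs the factor \<open>8/3\<close>, the tight case being a square of
  about half the width of its slot. The bonus comes from the right quarter of that slot, which such a
  square leaves uncovered, so that less mass is needed there.
\<close>

section \<open>Reach of a vertical slab\<close>

text \<open>This is the maximum from \<open>drop_height_eq\<close> with the width left free, so that
  the same function measures a whole slot and the part of it below a narrower square.\<close>

definition reach :: "placed list \<Rightarrow> real \<Rightarrow> real \<Rightarrow> real" where
  "reach P x w =
     Max (insert 0 (top_of ` {t \<in> set P. x < xpos t + side t \<and> xpos t < x + w}))"

lemma reach_nonneg: "0 \<le> reach P x w"
  unfolding reach_def by (rule Max_ge) auto

lemma top_of_le_reach:
  assumes "t \<in> set P" "x < xpos t + side t" "xpos t < x + w"
  shows "top_of t \<le> reach P x w"
  unfolding reach_def by (rule Max_ge) (use assms in auto)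

lemma reach_Nil: "reach [] x w = 0"
  by (simp add: reach_def)

lemma reach_mono:
  assumes "x' \<le> x" "x + w \<le> x' + w'"
  shows "reach P x w \<le> reach P x' w'"
  unfolding reach_def by (rule Max_mono) (use assms in auto)

lemma reach_snoc:
  "reach (P @ [s]) x w =
     (if x < xpos s + side s \<and> xpos s < x + w then max (reach P x w) (top_of s)
      else reach P x w)"
proof (cases "x < xpos s + side s \<and> xpos s < x + w")
  case True
  let ?A = "{t \<in> set P. x < xpos t + side t \<and> xpos t < x + w}"
  have "insert 0 (top_of ` {t \<in> set (P @ [s]). x < xpos t + side t \<and> xpos t < x + w})
    = insert (top_of s) (insert 0 (top_of ` ?A))"
    using True by auto
  then show ?thesis
    using True by (simp add: reach_def del: Max_insert) (subst Max_insert, auto simp: max.commute)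
next
  case False
  then have "{t \<in> set (P @ [s]). x < xpos t + side t \<and> xpos t < x + w} =
    {t \<in> set P. x < xpos t + side t \<and> xpos t < x + w}"
    by auto
  then show ?thesis using False by (auto simp: reach_def)
qed

lemma inverse_power_slot_exponent_less:
  assumes "0 < a" "a \<le> 1"
  shows "1 / 2 ^ Suc (slot_exponent a) < a"
proof (rule ccontr)
  assume "\<not> ?thesis"
  then have *: "a \<le> 1 / 2 ^ Suc (slot_exponent a)" by simp
  \<comment> \<open>The exponents must be bounded for \<open>GREATEST\<close> to be meaningful;
    \<open>n\<close> is such a bound.\<close>
  obtain n where n: "(1/2::real) ^ n < a"
    using real_arch_pow_inv[of a "1/2"] assms by auto
  have "k \<le> n" if "a \<le> 1 / 2 ^ k" for k
  proof (rule ccontr)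
    assume "\<not> k \<le> n"
    then have "(1/2::real) ^ k \<le> (1/2) ^ n" by (intro power_decreasing) auto
    with n that show False by (simp add: power_one_over)
  qed
  with * have "Suc (slot_exponent a) \<le> slot_exponent a"
    unfolding slot_exponent_def by (intro Greatest_le_nat) auto
  then show False by simp
qed

section \<open>The mass invariant and its sums over subslots\<close>

text \<open>The term \<open>1/10 * (1 - (x + w))\<close> is the bonus, and \<open>3/20 * w\<^sup>2\<close> the loss.\<close>

definition paid_on :: "placed list \<Rightarrow> (real \<Rightarrow> real) \<Rightarrow> real \<Rightarrow> real \<Rightarrow> bool" where
  "paid_on P \<Phi> x w \<longleftrightarrow>
     w * (reach P x w + 1/10 * (1 - (x + w))) - 3/20 * w\<^sup>2 \<le> \<Phi> (x + w) - \<Phi> x"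

text \<open>Leaving \<open>j\<close> unrestricted includes slots to the right of the strip; the
  bonus is negative there.\<close>

definition paid :: "placed list \<Rightarrow> (real \<Rightarrow> real) \<Rightarrow> bool" where
  "paid P \<Phi> \<longleftrightarrow> (\<forall>k j. paid_on P \<Phi> (real j / 2 ^ k) (1 / 2 ^ k))"

text \<open>Before any square arrives, uniform mass of density 1/10 funds the bonus, which never
  exceeds 1/10.\<close>

lemma paid_Nil: "paid [] (\<lambda>x. 1/10 * x)"
  unfolding paid_def paid_on_def
proof (intro allI)
  fix k j :: nat
  define x w where "x = real j / 2 ^ k" and "w = 1 / (2::real) ^ k"
  have "0 \<le> x" "0 \<le> w" by (auto simp: x_def w_def)
  then have "0 \<le> w * x" "0 \<le> w\<^sup>2" by simp_all
  then have "w * (reach [] x w + 1/10 * (1 - (x + w))) - 3/20 * w\<^sup>2 \<le> 1/10 * (x + w) - 1/10 * x"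
    by (simp add: reach_Nil algebra_simps power2_eq_square)
  then show "(1 / 2 ^ k) * (reach [] (real j / 2 ^ k) (1 / 2 ^ k) +
      1/10 * (1 - (real j / 2 ^ k + 1 / 2 ^ k))) - 3/20 * (1 / 2 ^ k)\<^sup>2
    \<le> 1/10 * (real j / 2 ^ k + 1 / 2 ^ k) - 1/10 * (real j / 2 ^ k)"
    unfolding x_def w_def .
qed

text \<open>The bonuses are taken at the right ends \<open>x + (i + 1) * w\<close>; compared with
  \<open>1/10 * (1 - x)\<close> they fall short by \<open>1/10 * w^2 * (1 + ... + M)\<close> in
  total, which is the last subtracted term.\<close>

lemma sum_paid_on:
  fixes \<Phi> :: "real \<Rightarrow> real"
  assumes "\<And>i. i < M \<Longrightarrow> paid_on P \<Phi> (x + real i * w) w"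
    and "\<And>i. i < M \<Longrightarrow> d \<le> reach P (x + real i * w) w" and "0 \<le> w"
  shows "real M * (w * (d + 1/10 * (1 - x)) - 3/20 * w\<^sup>2) - 1/20 * w\<^sup>2 * real M * (real M + 1)
    \<le> \<Phi> (x + real M * w) - \<Phi> x"
  using assms(1,2)
proof (induction M)
  case (Suc M)
  let ?y = "x + real M * w"
  have "paid_on P \<Phi> ?y w" "d \<le> reach P ?y w" using Suc.prems[of M] by auto
  moreover have "w * d \<le> w * reach P ?y w"
    using calculation(2) \<open>0 \<le> w\<close> by (rule mult_left_mono)
  ultimately have "w * (d + 1/10 * (1 - (?y + w))) - 3/20 * w\<^sup>2 \<le> \<Phi> (?y + w) - \<Phi> ?y"
    unfolding paid_on_def by (simp add: algebra_simps)
  moreover have "real M * (w * (d + 1/10 * (1 - x)) - 3/20 * w\<^sup>2) - 1/20 * w\<^sup>2 * real M * (real M + 1)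
    \<le> \<Phi> ?y - \<Phi> x"
    using Suc by simp
  moreover have "x + real (Suc M) * w = ?y + w" by (simp add: algebra_simps)
  ultimately show ?case
    by (simp add: field_simps power2_eq_square)
qed simp

text \<open>With \<open>W = M * w\<close>, merging the subslots is profitable: the larger loss gains
  \<open>3/20 * (W^2 - M * w^2)\<close> and the bonus, now taken only at the right end, gains
  \<open>1/20 * (W^2 - M * w^2)\<close>. Together with the payment for the square this covers
  \<open>W * a\<close>.\<close>

lemma paid_on_ancestor:
  fixes \<Phi> \<Phi>' :: "real \<Rightarrow> real"
  assumes M: "2 \<le> M" and w: "0 \<le> w"
    and paid: "\<And>i. i < M \<Longrightarrow> paid_on P \<Phi> (x + real i * w) w"
    and d: "\<And>i. i < M \<Longrightarrow> d \<le> reach P (x + real i * w) w"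
    and old: "paid_on P \<Phi> x (real M * w)"
    and reach: "reach P' x (real M * w) \<le> max (reach P x (real M * w)) (d + a)"
    and \<Phi>': "\<Phi>' (x + real M * w) - \<Phi>' x = \<Phi> (x + real M * w) - \<Phi> x + 13/5 * a\<^sup>2"
  shows "paid_on P' \<Phi>' x (real M * w)"
proof -
  define W where "W = real M * w"
  define Q where "Q = \<Phi>' (x + W) - \<Phi>' x"
  have W: "0 \<le> W" using w by (simp add: W_def)
  have claim: "W * (r + 1/10 * (1 - (x + W))) - 3/20 * W\<^sup>2 \<le> Q"
    if "r = reach P x W \<or> r = d + a" for r
    using that
  proof
    assume r: "r = reach P x W"
    have "0 \<le> a\<^sup>2" by simp
    then show ?thesis
      using old \<Phi>' unfolding r paid_on_def W_def[symmetric] Q_def by linarith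
  next
    assume r: "r = d + a"
    have "Q = \<Phi> (x + W) - \<Phi> x + 13/5 * a\<^sup>2" using \<Phi>' by (simp add: Q_def W_def)
    then have Q: "real M * (w * (d + 1/10 * (1 - x)) - 3/20 * w\<^sup>2) - 1/20 * w\<^sup>2 * real M * (real M + 1)
        + 13/5 * a\<^sup>2 \<le> Q"
      using sum_paid_on[of M P \<Phi> x w d, OF paid d w] by (simp add: W_def)
    \<comment> \<open>From \<open>M >= 2\<close>, \<open>W^2 - M * w^2\<close> is at least
      \<open>W^2 / 2\<close>. What remains is \<open>13/5 * a^2 - W * a + W^2 / 10\<close>;
      completing the square uses only \<open>5/52 < 1/10\<close> of the last term.\<close>
    have "0 \<le> w\<^sup>2 * (real M * (real M - 2))" using M by simp
    moreover have "0 \<le> (26/5 * a - W)\<^sup>2" "0 \<le> W\<^sup>2" by simp_all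
    ultimately have "0 \<le> 13/5 * a\<^sup>2 - W * a + 1/5 * (W\<^sup>2 - real M * w\<^sup>2)"
      unfolding W_def by (simp add: algebra_simps power2_eq_square)
    then show ?thesis
      using Q unfolding r W_def by (simp add: field_simps power2_eq_square)
  qed
  have "W * reach P' x W \<le> W * max (reach P x W) (d + a)"
    using reach W unfolding W_def by (rule mult_left_mono)
  moreover have "W * (max (reach P x W) (d + a) + 1/10 * (1 - (x + W))) - 3/20 * W\<^sup>2 \<le> Q"
    by (rule claim) linarith
  ultimately have "W * (reach P' x W + 1/10 * (1 - (x + W))) - 3/20 * W\<^sup>2 \<le> Q"
    by (simp add: distrib_left)
  then show ?thesis unfolding paid_on_def Q_def W_def .
qed

section \<open>The area bound for \<open>OPT\<close>\<close>

lemma open_square_eq_box: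
  "open_square s = box (xpos s, ypos s) (xpos s + side s, top_of s)"
  by (auto simp: open_square_def box_def Basis_prod_def top_of_def)

lemma emeasure_open_square:
  assumes "0 \<le> side s"
  shows "emeasure lborel (open_square s) = ennreal ((side s)\<^sup>2)"
  unfolding open_square_eq_box using assms
  by (subst emeasure_lborel_box) (auto simp: Basis_prod_def top_of_def prod.union_disjoint power2_eq_square)

text \<open>Area argument: the open squares are disjoint and lie in a box of width 1 and height
  \<open>packing_height Q\<close>.\<close>

lemma sum_squares_le_packing_height:
  assumes Q: "strip_packing Q" and pos: "\<forall>s \<in> set Q. 0 < side s"
  shows "(\<Sum>s\<leftarrow>Q. (side s)\<^sup>2) \<le> packing_height Q"
proof -
  let ?F = "\<lambda>i. open_square (Q ! i)"
  have top: "top_of s \<le> packing_height Q" if "s \<in> set Q" for s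
    unfolding packing_height_def by (rule Max_ge) (use that in auto)
  have h: "0 \<le> packing_height Q"
    unfolding packing_height_def by (rule Max_ge) auto
  have disj: "disjoint_family_on ?F {..<length Q}"
    unfolding disjoint_family_on_def
  proof (intro ballI impI)
    fix i j assume "i \<in> {..<length Q}" "j \<in> {..<length Q}" "i \<noteq> j"
    then show "?F i \<inter> ?F j = {}"
      using Q unfolding strip_packing_def overlap_def
      by (metis Int_commute lessThan_iff nat_neq_iff)
  qed
  have "(\<Union>i<length Q. ?F i) \<subseteq> box (0, 0) (1, packing_height Q)"
  proof safe
    fix i x y assume i: "i < length Q" and xy: "(x, y) \<in> ?F i"
    have "in_strip (Q ! i)" using Q i by (simp add: strip_packing_def)
    moreover have "top_of (Q ! i) \<le> packing_height Q" using i top by simp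
    ultimately show "(x, y) \<in> box (0, 0) (1, packing_height Q)"
      using xy by (auto simp: open_square_def in_strip_def top_of_def box_def Basis_prod_def)
  qed
  then have "emeasure lborel (\<Union>i<length Q. ?F i)
      \<le> emeasure lborel (box (0::real, 0::real) (1, packing_height Q))"
    by (rule emeasure_mono) simp
  also have "\<dots> = ennreal (packing_height Q)"
    using h by (subst emeasure_lborel_box) (auto simp: Basis_prod_def prod.union_disjoint)
  finally have "(\<Sum>i<length Q. emeasure lborel (?F i)) \<le> ennreal (packing_height Q)"
    by (subst sum_emeasure[OF _ disj]) (auto simp: open_square_eq_box)
  moreover have "(\<Sum>i<length Q. emeasure lborel (?F i)) = (\<Sum>i<length Q. ennreal ((side (Q ! i))\<^sup>2))"
    using pos by (intro sum.cong emeasure_open_square) (auto simp: less_imp_le)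
  ultimately have "(\<Sum>i<length Q. (side (Q ! i))\<^sup>2) \<le> packing_height Q"
    using h by (simp add: sum_nonneg)
  then show ?thesis
    by (simp add: sum_list_sum_nth atLeast0LessThan)
qed

lemma sum_squares_le_OPT:
  assumes "valid_input as" and "strip_packing P" "map side P = as"
  shows "(\<Sum>a\<leftarrow>as. a\<^sup>2) \<le> OPT as"
  unfolding OPT_def
proof (rule cInf_greatest)
  \<comment> \<open>\<open>P\<close> witnesses that the infimum is not taken over the empty
    set.\<close>
  show "{packing_height Q | Q. strip_packing Q \<and> map side Q = as} \<noteq> {}"
    using assms by blast
  fix h assume "h \<in> {packing_height Q | Q. strip_packing Q \<and> map side Q = as}"
  then obtain Q where Q: "h = packing_height Q" "strip_packing Q" "map side Q = as" by blast
  then have "set as = side ` set Q" by auto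
  then have "\<forall>s \<in> set Q. 0 < side s" using assms(1) by (auto simp: valid_input_def image_subset_iff)
  then have "(\<Sum>s\<leftarrow>Q. (side s)\<^sup>2) \<le> h"
    unfolding Q(1) by (rule sum_squares_le_packing_height[OF Q(2)])
  then show "(\<Sum>a\<leftarrow>as. a\<^sup>2) \<le> h"
    by (simp add: Q(3)[symmetric] o_def)
qed

section \<open>Placing one square\<close>

text \<open>In units of \<open>w'\<close> the coarse slot runs from \<open>j * M\<close> to
  \<open>(j + 1) * M\<close>, so comparing integers decides the case.\<close>

lemma dyadic_slot_cases:
  fixes k k' j j' :: nat
  assumes "k \<le> k'"
  defines "x \<equiv> real j / 2 ^ k" and "w \<equiv> 1 / 2 ^ k" and "x' \<equiv> real j' / 2 ^ k'" and "w' \<equiv> 1 / 2 ^ k'"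
  obtains "x' + w' \<le> x" | "x + w \<le> x'"
  | i :: nat where "i < 2 ^ (k' - k)" "x' = x + real i * w'"
proof -
  define M where "M = (2::nat) ^ (k' - k)"
  have M: "0 < M" by (simp add: M_def)
  have "(2::real) ^ k' = 2 ^ k * real M"
    using \<open>k \<le> k'\<close> by (simp add: M_def power_add[symmetric])
  then have x: "x = real (j * M) * w'" "x + w = real ((j + 1) * M) * w'" "x' = real j' * w'"
    "x' + w' = real (j' + 1) * w'"
    using M by (simp_all add: x_def w_def x'_def w'_def field_simps)
  have w': "0 < w'" by (simp add: w'_def)
  consider "j' + 1 \<le> j * M" | "(j + 1) * M \<le> j'" | "j * M \<le> j'" "j' < (j + 1) * M" by linarith
  then show thesis
  proof cases
    case 1
    then have "real (j' + 1) * w' \<le> real (j * M) * w'"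
      using w' by (intro mult_right_mono) (simp_all only: of_nat_le_iff less_imp_le)
    then show ?thesis using that(1) x by simp
  next
    case 2
    then have "real ((j + 1) * M) * w' \<le> real j' * w'"
      using w' by (intro mult_right_mono) (simp_all only: of_nat_le_iff less_imp_le)
    then show ?thesis using that(2) x by simp
  next
    case 3
    then have "x' = x + real (j' - j * M) * w'"
      by (simp add: x of_nat_diff algebra_simps)
    moreover have "j' - j * M < M" using 3 by (simp add: less_diff_conv2)
    ultimately show ?thesis using that(3) M_def by blast
  qed
qed

text \<open>Slots disjoint from \<open>{l..e}\<close> keep reach and mass, slots inside it get a new
  density, and larger slots containing it follow from \<open>paid_on_ancestor\<close>. The bottom
  \<open>d\<close> may lie below the reach of its own slot, because a square narrower than the slot
  can slip past obstacles.\<close>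

lemma slot_step:
  fixes \<Phi> :: "real \<Rightarrow> real"
  assumes paid: "paid P \<Phi>" and j: "j < 2 ^ k"
    and a: "1 / 2 ^ Suc k < a" "a \<le> 1 / 2 ^ k"
    and d: "\<And>i. i < 2 ^ k \<Longrightarrow> d \<le> reach P (real i / 2 ^ k) (1 / 2 ^ k)"
  obtains \<Phi>' where "paid (P @ [Placed (real j / 2 ^ k) d a]) \<Phi>'"
    "\<Phi>' 1 - \<Phi>' 0 = \<Phi> 1 - \<Phi> 0 + 13/5 * a\<^sup>2"
proof -
  define l w where "l = real j / 2 ^ k" and "w = 1 / (2::real) ^ k"
  define P' where "P' = P @ [Placed l d a]"
  define e where "e = l + w"
  define q where "q = e - w / 4"
  define t where "t = reach P' l w"
  \<comment> \<open>\<open>\<rho>\<close> is the density withheld from the last quarter \<open>{q..e}\<close> of the slot. If that quarter is too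
    high for this, the square has paid enough to give the bonus everywhere.\<close>
  define \<rho> where "\<rho> = (if reach P' q (w / 4) \<le> t - w / 5 then w / 5 else 0)"
  \<comment> \<open>The density of \<open>N\<close> is \<open>t + 1/10 * (1 - x)\<close>, lowered by
    \<open>\<rho>\<close> to the right of \<open>q\<close>. Integrating the linear part over a slot
    of width \<open>v\<close> yields its bonus plus \<open>v^2 / 20\<close>; with the loss this
    leaves slack \<open>v^2 / 5\<close>.\<close>
  define N where "N x = t * x + 1/10 * (x - x\<^sup>2 / 2) - \<rho> * max 0 (x - q)" for x
  \<comment> \<open>Any surplus of the budget becomes a point mass at \<open>e\<close>. The strict
    \<open>x < e\<close> lets slots ending at \<open>e\<close> receive it.\<close>
  define \<Phi>' where "\<Phi>' x = (if x \<le> l then \<Phi> x else if x < e then \<Phi> l + N x - N l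
    else \<Phi> x + 13/5 * a\<^sup>2)" for x
  have w: "0 < w" "w / 2 < a" "a \<le> w" using a by (auto simp: w_def)
  have "real (j + 1) \<le> real (2 ^ k)" using j by (simp only: of_nat_le_iff)
  then have l: "0 \<le> l" "e \<le> 1" "l < e" "l \<le> q" "q < e" and q: "q = l + 3 / 4 * w"
    using w by (auto simp: l_def w_def e_def q_def field_simps)
  have \<rho>: "0 \<le> \<rho>" "\<rho> \<le> w / 5" using w by (auto simp: \<rho>_def)
  have reach: "reach P' x v = (if x < l + a \<and> l < x + v then max (reach P x v) (d + a) else reach P x v)"
    for x v unfolding P'_def reach_snoc by (simp add: top_of_def)
  define r where "r = reach P l w"
  have t: "t = max r (d + a)" using reach[of l w] w by (simp add: t_def r_def)
  have dr: "d \<le> r" using d[OF j] by (simp add: r_def l_def w_def)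
  have paid_l: "w * (r + 1/10 * (1 - e)) - 3/20 * w\<^sup>2 \<le> \<Phi> e - \<Phi> l"
    using paid unfolding paid_def paid_on_def by (simp add: r_def e_def l_def w_def)

  have budget: "N e - N l \<le> \<Phi> e - \<Phi> l + 13/5 * a\<^sup>2"
  proof -
    have "N e - N l = w * (t + 1/10 * (1 - e)) + w\<^sup>2 / 20 - \<rho> * w / 4"
      using l w by (simp add: N_def q_def) (simp add: e_def field_simps power2_eq_square)
    moreover have "w * t + w\<^sup>2 / 20 - \<rho> * w / 4 \<le> w * r - 3/20 * w\<^sup>2 + 13/5 * a\<^sup>2"
    proof (cases "reach P' q (w / 4) \<le> t - w / 5")
      case True
      have "t \<le> r + a" using t dr w by auto
      then have "w * t \<le> w * (r + a)" using w by (intro mult_left_mono) auto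
      \<comment> \<open>The withheld mass \<open>w^2 / 20\<close> cancels the extra
        \<open>w^2 / 20\<close> of the bonus. The product is
        \<open>13/5 * a^2 - w * a - 3/20 * w^2\<close>, which vanishes at
        \<open>a = w / 2\<close>.\<close>
      moreover have "0 \<le> (a - w / 2) * (13/5 * a + 3/10 * w)" using w by simp
      ultimately show ?thesis
        using True by (simp add: \<rho>_def field_simps power2_eq_square)
    next
      case False
      \<comment> \<open>Nothing is withheld here. Either the square enters the last quarter, so that
        \<open>a > 3/4 * w\<close> and \<open>4/3 + 16/45 < 13/5\<close> suffices, or that quarter
        was already high before, so that \<open>t - r < w / 5\<close>.\<close>
      have "w * (t - r) + w\<^sup>2 / 5 \<le> 13/5 * a\<^sup>2"
      proof (cases "q < l + a")
        case True
        have "t - r \<le> a" using t dr w by auto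
        moreover have wa: "w \<le> 4 / 3 * a" using True q by simp
        ultimately have "w * (t - r) \<le> w * a" "w * a \<le> 4 / 3 * a\<^sup>2"
          using w by (simp_all add: mult_left_mono mult_right_mono power2_eq_square)
        moreover have "w\<^sup>2 \<le> 16 / 9 * a\<^sup>2"
          using power_mono[OF wa, of 2] w by (simp add: power_mult_distrib power_divide)
        moreover have "0 \<le> a\<^sup>2" by simp
        ultimately show ?thesis by linarith
      next
        case nq: False
        have "reach P' q (w / 4) \<le> r"
          using nq reach[of q "w / 4"] reach_mono[of l q "w / 4" w P] l
          by (simp add: r_def q_def e_def)
        then have "t - r \<le> w / 5" using False by simp
        then have "w * (t - r) \<le> w * (w / 5)" using w by (intro mult_left_mono) auto
        moreover have "(w / 2)\<^sup>2 \<le> a\<^sup>2" using w by (intro power_mono) auto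
        moreover have "0 \<le> a\<^sup>2" by simp
        ultimately show ?thesis unfolding power2_eq_square by linarith
      qed
      then show ?thesis using False by (simp add: \<rho>_def algebra_simps)
    qed
    ultimately show ?thesis using paid_l by (simp add: algebra_simps)
  qed

  have outside: "paid_on P' \<Phi>' x v"
    if "paid_on P \<Phi> x v" "0 \<le> v" "x + v \<le> l \<or> e \<le> x" for x v
  proof -
    have "reach P' x v = reach P x v"
      using that w by (auto simp: reach e_def)
    moreover have "\<Phi>' (x + v) - \<Phi>' x = \<Phi> (x + v) - \<Phi> x"
      using that l by (auto simp: \<Phi>'_def)
    ultimately show ?thesis using that(1) by (simp add: paid_on_def)
  qed

  have inside: "paid_on P' \<Phi>' x v"
    if v: "0 < v" "l \<le> x" "x + v \<le> e"
      and c: "x + v \<le> q \<or> q \<le> x \<or> w / 2 \<le> v" for x v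
  proof -
    have le_t: "reach P' x v \<le> t"
      unfolding t_def using v by (intro reach_mono) (auto simp: e_def)
    have N: "N (x + v) - N x = v * (t + 1/10 * (1 - (x + v))) + v\<^sup>2 / 20
        - \<rho> * (max 0 (x + v - q) - max 0 (x - q))"
      by (simp add: N_def field_simps power2_eq_square)
    have *: "v * reach P' x v - 3/20 * v\<^sup>2 \<le> v * t + v\<^sup>2 / 20 - \<rho> * (max 0 (x + v - q) - max 0 (x - q))"
    proof -
      have vt: "v * reach P' x v \<le> v * t" using le_t v by (intro mult_left_mono) auto
      have v2: "0 \<le> v\<^sup>2" by simp
      consider "x + v \<le> q" | "q \<le> x" | "w / 2 \<le> v" using c by blast
      then show ?thesis
      proof cases
        case 1
        then have m: "max 0 (x + v - q) - max 0 (x - q) = 0" using v by simp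
        show ?thesis unfolding m using vt v2 by linarith
      next
        case 2
        have "reach P' x v \<le> reach P' q (w / 4)"
          using 2 v by (intro reach_mono) (auto simp: q_def)
        then have "reach P' x v \<le> t - \<rho>" using le_t by (auto simp: \<rho>_def)
        then have "v * reach P' x v \<le> v * (t - \<rho>)" using v by (intro mult_left_mono) auto
        then have "v * reach P' x v \<le> v * t - \<rho> * v" by (simp only: right_diff_distrib mult.commute)
        moreover have m: "max 0 (x + v - q) - max 0 (x - q) = v" using 2 v by simp
        ultimately show ?thesis unfolding m using v2 by linarith
      next
        case 3
        \<comment> \<open>This fixes the value \<open>w / 5\<close> of \<open>\<rho>\<close>: the
          withheld mass is at most \<open>w^2 / 20\<close>, which the slack \<open>v^2 / 5\<close>
          covers exactly from \<open>v = w / 2\<close> on.\<close>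
        have "max 0 (x + v - q) - max 0 (x - q) \<le> w / 4" using v w by (auto simp: q_def max_def)
        then have "\<rho> * (max 0 (x + v - q) - max 0 (x - q)) \<le> w / 5 * (w / 4)"
          using \<rho> w v by (intro mult_mono) auto
        moreover have "(w / 2)\<^sup>2 \<le> v\<^sup>2" using 3 w by (intro power_mono) auto
        ultimately show ?thesis using vt unfolding power2_eq_square by linarith
      qed
    qed
    have "N (x + v) - N x \<le> \<Phi>' (x + v) - \<Phi>' x"
      using v budget by (auto simp: \<Phi>'_def)
    then show ?thesis
      unfolding paid_on_def using * N by (simp add: algebra_simps)
  qed

  have "paid_on P' \<Phi>' (real j' / 2 ^ k') (1 / 2 ^ k')" for k' j'
  proof -
    define x v where "x = real j' / 2 ^ k'" and "v = 1 / (2::real) ^ k'"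
    have v: "0 < v" by (simp add: v_def)
    have old: "paid_on P \<Phi> x v" using paid by (simp add: paid_def x_def v_def)
    have "paid_on P' \<Phi>' x v"
    proof (cases "k \<le> k'")
      case True
      define M where "M = (2::nat) ^ (k' - k)"
      have "(2::real) ^ k' = 2 ^ k * real M"
        using True by (simp add: M_def power_add[symmetric])
      then have wM: "w = real M * v" by (simp add: w_def v_def M_def field_simps)
      from dyadic_slot_cases[OF True, of j' j, folded x_def l_def w_def v_def M_def]
      show ?thesis
      proof cases
        case 1
        then show ?thesis using outside old v by auto
      next
        case 2
        then show ?thesis using outside old v by (auto simp: e_def)
      next
        case (3 i)
        have "real (i + 1) * v \<le> real M * v"
          using 3(1) v by (intro mult_right_mono) (simp_all only: of_nat_le_iff less_imp_le)
        then have x: "l \<le> x" "x + v \<le> e" using 3 v by (auto simp: e_def wM algebra_simps)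
        \<comment> \<open>Since \<open>q\<close> lies three quarters into the slot, no subslot of
          width at most \<open>w / 4\<close> straddles it; only widths \<open>w\<close> and
          \<open>w / 2\<close> remain.\<close>
        have "x + v \<le> q \<or> q \<le> x \<or> w / 2 \<le> v"
        proof (cases "k' - k \<ge> 2")
          case True
          define K where "K = (2::nat) ^ (k' - k - 2)"
          have "M = 2 ^ (2 + (k' - k - 2))" using True unfolding M_def by (metis le_add_diff_inverse)
          then have "M = 4 * K" by (simp add: K_def power_add)
          then have qK: "q = l + real (3 * K) * v" by (simp add: q wM)
          show ?thesis
          proof (cases "i + 1 \<le> 3 * K")
            case True
            then have "real (i + 1) * v \<le> real (3 * K) * v"
              using v by (intro mult_right_mono) (simp_all only: of_nat_le_iff less_imp_le)
            then show ?thesis using 3 qK by (simp add: algebra_simps)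
          next
            case False
            then have "real (3 * K) * v \<le> real i * v"
              using v by (intro mult_right_mono) (simp_all only: of_nat_le_iff less_imp_le)
            then show ?thesis using 3 qK by simp
          qed
        next
          case False
          then have "k' - k = 0 \<or> k' - k = 1" by linarith
          then show ?thesis using v wM by (auto simp: M_def)
        qed
        then show ?thesis using inside v x by blast
      qed
    next
      case False
      then have kk: "k' \<le> k" by simp
      define M where "M = (2::nat) ^ (k - k')"
      have two_M: "(2::real) ^ k = 2 ^ k' * real M"
        using kk by (simp add: M_def power_add[symmetric])
      then have vM: "v = real M * w" by (simp add: w_def v_def M_def field_simps)
      have M2: "2 \<le> M" using False self_le_power[of 2 "k - k'"] by (simp add: M_def)
      from dyadic_slot_cases[OF kk, of j j', folded x_def l_def w_def v_def M_def]
      show ?thesis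
      proof cases
        case 1
        then show ?thesis using outside old v by (auto simp: e_def)
      next
        case 2
        then show ?thesis using outside old v by auto
      next
        case (3 i)
        have "real (i + 1) * w \<le> real M * w"
          using 3(1) w by (intro mult_right_mono) (simp_all only: of_nat_le_iff less_imp_le)
        then have x: "x \<le> l" "e \<le> x + v" using 3 w by (auto simp: e_def vM algebra_simps)
        \<comment> \<open>A slot containing a slot of the strip is itself in the strip; hence so are
          its subslots, and the assumption on \<open>d\<close> applies to them.\<close>
        have "x < 1" using x l by simp
        then have "real j' < real (2 ^ k')" by (simp add: x_def field_simps)
        then have "j' + 1 \<le> 2 ^ k'" by (simp only: of_nat_less_iff)
        then have "(j' + 1) * M \<le> 2 ^ k' * M" by (rule mult_right_mono) simp
        also have "\<dots> = 2 ^ k" using kk by (simp add: M_def power_add[symmetric])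
        finally have jM: "(j' + 1) * M \<le> 2 ^ k" .
        have sub: "x + real i * w = real (j' * M + i) / 2 ^ k" for i
          by (simp add: x_def w_def two_M) (simp add: M_def field_simps)
        have "paid_on P' \<Phi>' x (real M * w)"
        proof (rule paid_on_ancestor[OF M2])
          show "paid_on P \<Phi> (x + real i * w) w" for i
            using paid unfolding sub paid_def unfolding w_def by blast
          show "d \<le> reach P (x + real i * w) w" if "i < M" for i
            unfolding sub unfolding w_def using jM that by (intro d) simp
          show "paid_on P \<Phi> x (real M * w)" using old vM by simp
          show "reach P' x (real M * w) \<le> max (reach P x (real M * w)) (d + a)"
            by (auto simp: reach)
          show "\<Phi>' (x + real M * w) - \<Phi>' x = \<Phi> (x + real M * w) - \<Phi> x + 13/5 * a\<^sup>2"
            using x l by (auto simp: \<Phi>'_def vM)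
        qed (use w in simp)
        then show ?thesis by (simp add: vM)
      qed
    qed
    then show ?thesis unfolding x_def v_def .
  qed
  then have "paid (P @ [Placed (real j / 2 ^ k) d a]) \<Phi>'"
    unfolding paid_def P'_def l_def by blast
  moreover have "\<Phi>' 1 - \<Phi>' 0 = \<Phi> 1 - \<Phi> 0 + 13/5 * a\<^sup>2"
    using l by (auto simp: \<Phi>'_def)
  ultimately show thesis by (rule that)
qed

section \<open>The whole run and the competitive ratio\<close>

lemma slot_algorithm_paid:
  assumes "online_run slot_algorithm as P" "valid_input as"
  shows "\<exists>\<Phi>. paid P \<Phi> \<and> \<Phi> 1 - \<Phi> 0 = 13/5 * (\<Sum>a\<leftarrow>as. a\<^sup>2) + 1/10"
  using assms
proof (induction rule: online_run.induct)
  case Nil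
  show ?case using paid_Nil by (intro exI[of _ "\<lambda>x. 1/10 * x"]) simp
next
  case (snoc as P a s)
  then have a: "0 < a" "a \<le> 1" and as: "valid_input as"
    by (auto simp: valid_input_def)
  then obtain \<Phi> where \<Phi>: "paid P \<Phi>" "\<Phi> 1 - \<Phi> 0 = 13/5 * (\<Sum>a\<leftarrow>as. a\<^sup>2) + 1/10"
    using snoc.IH by blast
  have "map side P = as"
    using tetris_gravity_algorithm_slot_algorithm snoc.hyps(1) as
    unfolding tetris_gravity_algorithm_def by blast
  then have P: "\<forall>t \<in> set P. 0 < side t"
    using as by (force simp: valid_input_def)
  define k where "k = slot_exponent a"
  have ak: "1 / 2 ^ Suc k < a" "a \<le> 1 / 2 ^ k"
    unfolding k_def using a
    by (simp_all only: inverse_power_slot_exponent_less le_inverse_power_slot_exponent)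
  from snoc.hyps(2) obtain j where j: "j < 2 ^ k"
    and low: "\<And>i. i < 2 ^ k \<Longrightarrow>
      drop_height P (real j / 2 ^ k) a \<le> drop_height P (real i / 2 ^ k) a"
    and s: "s = Placed (real j / 2 ^ k) (drop_height P (real j / 2 ^ k) a) a"
    unfolding slot_algorithm_def Let_def k_def by blast
  have drop: "drop_height P x a = reach P x a" for x
    using a(1) P by (simp add: drop_height_eq reach_def)
  \<comment> \<open>The algorithm compares drops of width \<open>a\<close>; widening to the full
    slot can only raise the reach.\<close>
  have "drop_height P (real j / 2 ^ k) a \<le> reach P (real i / 2 ^ k) (1 / 2 ^ k)" if "i < 2 ^ k" for i
    using low[OF that] reach_mono[of "real i / 2 ^ k" "real i / 2 ^ k" a "1 / 2 ^ k" P] ak(2)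
    unfolding drop by simp
  from slot_step[OF \<Phi>(1) j ak this] obtain \<Phi>' where
    "paid (P @ [s]) \<Phi>'" "\<Phi>' 1 - \<Phi>' 0 = \<Phi> 1 - \<Phi> 0 + 13/5 * a\<^sup>2"
    unfolding s by blast
  then show ?case using \<Phi>(2) by (intro exI[of _ \<Phi>']) simp
qed

lemma packing_height_le_reach:
  assumes "strip_packing P" "\<forall>t \<in> set P. 0 < side t"
  shows "packing_height P \<le> reach P 0 1"
  unfolding packing_height_def
proof (rule Max.boundedI)
  fix h assume "h \<in> insert 0 (top_of ` set P)"
  then show "h \<le> reach P 0 1"
  proof
    assume "h \<in> top_of ` set P"
    then obtain t where t: "t \<in> set P" "h = top_of t" by blast
    then have "in_strip t" "0 < side t" using assms by (auto simp: strip_packing_def)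
    then show ?thesis
      unfolding t(2) by (intro top_of_le_reach t(1)) (auto simp: in_strip_def)
  qed (simp add: reach_nonneg)
qed auto

theorem theorem2:
  "tetris_gravity_algorithm slot_algorithm \<and> asymptotically_competitive 2.6154 slot_algorithm"
proof
  show "tetris_gravity_algorithm slot_algorithm"
    by (rule tetris_gravity_algorithm_slot_algorithm)
  have "packing_height P \<le> 2.6154 * OPT as + 1/4"
    if as: "valid_input as" and run: "online_run slot_algorithm as P" for as P
  proof -
    have P: "map side P = as" "strip_packing P"
      using tetris_gravity_algorithm_slot_algorithm as run
      unfolding tetris_gravity_algorithm_def tetris_gravity_packing_def by blast+
    have pos: "\<forall>t \<in> set P. 0 < side t"
      using as P(1) by (force simp: valid_input_def)
    obtain \<Phi> where \<Phi>: "paid P \<Phi>" "\<Phi> 1 - \<Phi> 0 = 13/5 * (\<Sum>a\<leftarrow>as. a\<^sup>2) + 1/10"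
      using slot_algorithm_paid[OF run as] by blast
    \<comment> \<open>For the whole strip the bonus is 0, and 1/4 is the loss 3/20 plus the initial
      mass 1/10.\<close>
    have "paid_on P \<Phi> (real 0 / 2 ^ 0) (1 / 2 ^ 0)"
      using \<Phi>(1) unfolding paid_def by blast
    then have "reach P 0 1 \<le> 13/5 * (\<Sum>a\<leftarrow>as. a\<^sup>2) + 1/4"
      using \<Phi>(2) by (simp add: paid_on_def)
    moreover have "(\<Sum>a\<leftarrow>as. a\<^sup>2) \<le> OPT as"
      by (rule sum_squares_le_OPT[OF as P(2,1)])
    moreover have "0 \<le> (\<Sum>a\<leftarrow>as. a\<^sup>2)" by (intro sum_list_nonneg) auto
    ultimately show ?thesis
      using packing_height_le_reach[OF P(2) pos] by simp
  qed
  then show "asymptotically_competitive 2.6154 slot_algorithm"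
    unfolding asymptotically_competitive_def by blast
qed

end
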